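(* Let $\mathcal{Q}$ be a quasi-abelian category and let $\eta = (\mathcal{T}_i)_{i \in [0,1]} \in \mathfrak{T}(\mathcal{Q})$. Then every $M\in \mathcal{Q}$ has a unique (up to isomorphism) Harder-Narasimhan filtration with respect to $\eta$ in $\mathcal{Q}$, that is, a filtration $$0 = M_0 \subsetneq M_1 \subsetneq \dots \subsetneq M_n = M$$ of $M$ in $\mathcal{Q}$ such that, for some $r_1,\dots,r_n\in[0,1]$, (HN1) $M_k / M_{k-1} \in \mathcal{P}^{\eta}_{r_k}$ for all $1\leq k \leq n$; (HN2) $r_k > r_{k'}$ if and only if $k< k'$.
   Context: An additive category is pre-abelian if every morphism has a kernel and a cokernel. It is quasi-abelian if it is pre-abelian and cokernels are stable under pullback and kernels are stable under pushout. A short exact sequence $0 \to X \xrightarrow{f} Y \xrightarrow{g} Z \to 0$ in a pre-abelian category is a composable pair with $f$ a kernel of $g$ and $g$ a cokernel of $f$. A torsion pair in a pre-abelian category $\mathcal{B}$ is an ordered pair $(\mathcal{T},\mathcal{F})$ of full subcategories (closed under isomorphism) such that $\mathrm{Hom}_{\mathcal{B}}(T,F)=0$ for all $T\in\mathcal{T}$, $F\in\mathcal{F}$, and for every $M \in \mathcal{B}$ there is a short exact sequence $0 \to {}_{\mathcal{T}}M \to M \to M_{\mathcal{F}} \to 0$ in $\mathcal{B}$ with ${}_{\mathcal{T}}M\in\mathcal{T}$ and $M_{\mathcal{F}}\in\mathcal{F}$. This sequence is unique up to isomorphism, and ${}_{\mathcal{T}}M$ is regarded as a subobject of $M$. Then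 $\mathcal{T}$ is called a torsion class and $\mathcal{F}$ its associated torsionfree class. For a pre-abelian category $\mathcal{C}$, consider order reversing maps $\eta$ from the real interval $[0,1]$ to the torsion classes of $\mathcal{C}$ (ordered by inclusion), $i\mapsto\mathcal{T}_i$, with $\mathcal{T}_0=\mathcal{C}$ and $\mathcal{T}_1=0$ (so $\mathcal{T}_r\subseteq\mathcal{T}_{r'}$ whenever $r\ge r'$). Such $\eta$ is quasi-Noetherian (resp. weakly-Artinian) if for every interval $(a,b)\subset[0,1]$ there exists $s\in(a,b)$ such that ${}_{\mathcal{T}_r}M\subseteq{}_{\mathcal{T}_s}M$ (resp. ${}_{\mathcal{T}_s}M\subseteq{}_{\mathcal{T}_r}M$) for all $r\in(a,b)$ and $M\in\mathcal{C}$. $\mathfrak{T}(\mathcal{C})$ is the set of all $\eta$ that are both quasi-Noetherian and weakly-Artinian. For $\eta=(\mathcal{T}_i)_{i\in[0,1]}\in\mathfrak{T}(\mathcal{C})$ let $\mathcal{F}_i$ be the torsionfree class associated to $\mathcal{T}_i$, and set $\mathcal{P}^{\eta}_0=\bigcap_{s>0}\mathcal{F}_s$, $\mathcal{P}^{\eta}_r=\big(\bigcap_{s<r}\mathcal{T}_s\big)\cap\big(\bigcap_{s>r}\mathcal{F}_s\big)$ for $r\in(0,1)$, and $\mathcal{P}^{\eta}_1=\bigcap_{s<1}\mathcal{T}_s$, where the indices $s$ range over $[0,1]$. In a filtration in $\mathcal{Q}$ all $M_k$ are objects of $\mathcal{Q}$ and each inclusion fits into a short exact sequence $0\to M_{k-1}\to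 M_k\to M_k/M_{k-1}\to 0$ in $\mathcal{Q}$. *)

theory Defs
  imports Complex_Main "HOL-Algebra.Group"
begin

section \<open>Categories\<close>

text \<open>
  Hom-sets are disjoint, since every arrow carries its domain and codomain. The value of
  \<open>Comp\<close> is only constrained on composable pairs, that of \<open>Plus\<close> on parallel pairs.
\<close>

record ('o, 'm) add_cat =
  Obj :: "'o set"
  Arr :: "'m set"
  Dom :: "'m \<Rightarrow> 'o"
  Cod :: "'m \<Rightarrow> 'o"
  Id :: "'o \<Rightarrow> 'm"
  Comp :: "'m \<Rightarrow> 'm \<Rightarrow> 'm"  (infixr "\<cdot>\<index>" 75)
  Plus :: "'m \<Rightarrow> 'm \<Rightarrow> 'm"
  Zero :: "'o \<Rightarrow> 'o \<Rightarrow> 'm"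

definition Hom :: "('o, 'm, 'z) add_cat_scheme \<Rightarrow> 'o \<Rightarrow> 'o \<Rightarrow> 'm set" where
  "Hom C X Y = {f \<in> Arr C. Dom C f = X \<and> Cod C f = Y}"

definition Hom_group :: "('o, 'm, 'z) add_cat_scheme \<Rightarrow> 'o \<Rightarrow> 'o \<Rightarrow> 'm monoid" where
  "Hom_group C X Y = \<lparr>carrier = Hom C X Y, monoid.mult = Plus C, one = Zero C X Y\<rparr>"

locale category =
  fixes C :: "('o, 'm, 'z) add_cat_scheme" (structure)
  assumes Dom_in_Obj: "f \<in> Arr C \<Longrightarrow> Dom C f \<in> Obj C"
    and Cod_in_Obj: "f \<in> Arr C \<Longrightarrow> Cod C f \<in> Obj C"
    and Id_in_Hom: "X \<in> Obj C \<Longrightarrow> Id C X \<in> Hom C X X"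
    and Comp_in_Hom: "\<lbrakk>f \<in> Hom C X Y; g \<in> Hom C Y Z\<rbrakk> \<Longrightarrow> g \<cdot> f \<in> Hom C X Z"
    and Comp_Id: "f \<in> Hom C X Y \<Longrightarrow> f \<cdot> Id C X = f"
    and Id_Comp: "f \<in> Hom C X Y \<Longrightarrow> Id C Y \<cdot> f = f"
    and Comp_assoc: "\<lbrakk>f \<in> Hom C W X; g \<in> Hom C X Y; h \<in> Hom C Y Z\<rbrakk>
      \<Longrightarrow> (h \<cdot> g) \<cdot> f = h \<cdot> (g \<cdot> f)"

definition is_iso :: "('o, 'm, 'z) add_cat_scheme \<Rightarrow> 'm \<Rightarrow> bool" where
  "is_iso C f \<longleftrightarrow> f \<in> Arr C \<and>
     (\<exists>g \<in> Hom C (Cod C f) (Dom C f).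
        g \<cdot>\<^bsub>C\<^esub> f = Id C (Dom C f) \<and> f \<cdot>\<^bsub>C\<^esub> g = Id C (Cod C f))"

definition isomorphic :: "('o, 'm, 'z) add_cat_scheme \<Rightarrow> 'o \<Rightarrow> 'o \<Rightarrow> bool" where
  "isomorphic C X Y \<longleftrightarrow> (\<exists>f \<in> Hom C X Y. is_iso C f)"

definition zero_object :: "('o, 'm, 'z) add_cat_scheme \<Rightarrow> 'o \<Rightarrow> bool" where
  "zero_object C X \<longleftrightarrow> X \<in> Obj C \<and>
     (\<forall>Y \<in> Obj C. (\<exists>!f. f \<in> Hom C X Y) \<and> (\<exists>!f. f \<in> Hom C Y X))"

definition is_pullback ::
    "('o, 'm, 'z) add_cat_scheme \<Rightarrow> 'm \<Rightarrow> 'm \<Rightarrow> 'm \<Rightarrow> 'm \<Rightarrow> bool" where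
  "is_pullback C f g p q \<longleftrightarrow>
     {f, g, p, q} \<subseteq> Arr C \<and> Cod C f = Cod C g \<and> Dom C p = Dom C q \<and>
     Cod C p = Dom C f \<and> Cod C q = Dom C g \<and> f \<cdot>\<^bsub>C\<^esub> p = g \<cdot>\<^bsub>C\<^esub> q \<and>
     (\<forall>W. \<forall>a \<in> Hom C W (Dom C f). \<forall>b \<in> Hom C W (Dom C g).
        f \<cdot>\<^bsub>C\<^esub> a = g \<cdot>\<^bsub>C\<^esub> b \<longrightarrow>
        (\<exists>!u. u \<in> Hom C W (Dom C p) \<and> p \<cdot>\<^bsub>C\<^esub> u = a \<and> q \<cdot>\<^bsub>C\<^esub> u = b))"

definition is_pushout ::
    "('o, 'm, 'z) add_cat_scheme \<Rightarrow> 'm \<Rightarrow> 'm \<Rightarrow> 'm \<Rightarrow> 'm \<Rightarrow> bool" where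
  "is_pushout C f g p q \<longleftrightarrow>
     {f, g, p, q} \<subseteq> Arr C \<and> Dom C f = Dom C g \<and> Cod C p = Cod C q \<and>
     Dom C p = Cod C f \<and> Dom C q = Cod C g \<and> p \<cdot>\<^bsub>C\<^esub> f = q \<cdot>\<^bsub>C\<^esub> g \<and>
     (\<forall>W. \<forall>a \<in> Hom C (Cod C f) W. \<forall>b \<in> Hom C (Cod C g) W.
        a \<cdot>\<^bsub>C\<^esub> f = b \<cdot>\<^bsub>C\<^esub> g \<longrightarrow>
        (\<exists>!u. u \<in> Hom C (Cod C p) W \<and> u \<cdot>\<^bsub>C\<^esub> p = a \<and> u \<cdot>\<^bsub>C\<^esub> q = b))"


section \<open>Additive, pre-abelian and quasi-abelian categories\<close>

locale preadditive_category = category +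
  assumes Hom_comm_group: "\<lbrakk>X \<in> Obj C; Y \<in> Obj C\<rbrakk> \<Longrightarrow> comm_group (Hom_group C X Y)"
    and Comp_Plus: "\<lbrakk>f \<in> Hom C X Y; g \<in> Hom C X Y; h \<in> Hom C Y Z\<rbrakk>
      \<Longrightarrow> h \<cdot> Plus C f g = Plus C (h \<cdot> f) (h \<cdot> g)"
    and Plus_Comp: "\<lbrakk>f \<in> Hom C X Y; g \<in> Hom C Y Z; h \<in> Hom C Y Z\<rbrakk>
      \<Longrightarrow> Plus C g h \<cdot> f = Plus C (g \<cdot> f) (h \<cdot> f)"

definition is_biproduct ::
    "('o, 'm, 'z) add_cat_scheme \<Rightarrow> 'o \<Rightarrow> 'o \<Rightarrow> 'o \<Rightarrow> 'm \<Rightarrow> 'm \<Rightarrow> 'm \<Rightarrow> 'm \<Rightarrow> bool" where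
  "is_biproduct C X Y S i\<^sub>1 i\<^sub>2 p\<^sub>1 p\<^sub>2 \<longleftrightarrow> S \<in> Obj C \<and>
     i\<^sub>1 \<in> Hom C X S \<and> i\<^sub>2 \<in> Hom C Y S \<and> p\<^sub>1 \<in> Hom C S X \<and> p\<^sub>2 \<in> Hom C S Y \<and>
     p\<^sub>1 \<cdot>\<^bsub>C\<^esub> i\<^sub>1 = Id C X \<and> p\<^sub>2 \<cdot>\<^bsub>C\<^esub> i\<^sub>2 = Id C Y \<and>
     p\<^sub>1 \<cdot>\<^bsub>C\<^esub> i\<^sub>2 = Zero C Y X \<and> p\<^sub>2 \<cdot>\<^bsub>C\<^esub> i\<^sub>1 = Zero C X Y \<and>
     Plus C (i\<^sub>1 \<cdot>\<^bsub>C\<^esub> p\<^sub>1) (i\<^sub>2 \<cdot>\<^bsub>C\<^esub> p\<^sub>2) = Id C S"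

locale additive_category = preadditive_category +
  assumes ex_zero_object: "\<exists>X. zero_object C X"
    and ex_biproduct: "\<lbrakk>X \<in> Obj C; Y \<in> Obj C\<rbrakk>
      \<Longrightarrow> \<exists>S i\<^sub>1 i\<^sub>2 p\<^sub>1 p\<^sub>2. is_biproduct C X Y S i\<^sub>1 i\<^sub>2 p\<^sub>1 p\<^sub>2"

definition is_kernel :: "('o, 'm, 'z) add_cat_scheme \<Rightarrow> 'm \<Rightarrow> 'm \<Rightarrow> bool" where
  "is_kernel C k f \<longleftrightarrow>
     k \<in> Arr C \<and> f \<in> Arr C \<and> Cod C k = Dom C f \<and>
     f \<cdot>\<^bsub>C\<^esub> k = Zero C (Dom C k) (Cod C f) \<and>
     (\<forall>W. \<forall>h \<in> Hom C W (Dom C f). f \<cdot>\<^bsub>C\<^esub> h = Zero C W (Cod C f) \<longrightarrow>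
        (\<exists>!u. u \<in> Hom C W (Dom C k) \<and> k \<cdot>\<^bsub>C\<^esub> u = h))"

definition is_cokernel :: "('o, 'm, 'z) add_cat_scheme \<Rightarrow> 'm \<Rightarrow> 'm \<Rightarrow> bool" where
  "is_cokernel C c f \<longleftrightarrow>
     c \<in> Arr C \<and> f \<in> Arr C \<and> Dom C c = Cod C f \<and>
     c \<cdot>\<^bsub>C\<^esub> f = Zero C (Dom C f) (Cod C c) \<and>
     (\<forall>W. \<forall>h \<in> Hom C (Cod C f) W. h \<cdot>\<^bsub>C\<^esub> f = Zero C (Dom C f) W \<longrightarrow>
        (\<exists>!u. u \<in> Hom C (Cod C c) W \<and> u \<cdot>\<^bsub>C\<^esub> c = h))"

definition short_exact :: "('o, 'm, 'z) add_cat_scheme \<Rightarrow> 'm \<Rightarrow> 'm \<Rightarrow> bool" where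
  "short_exact C f g \<longleftrightarrow> is_kernel C f g \<and> is_cokernel C g f"

locale pre_abelian_category = additive_category +
  assumes ex_kernel: "f \<in> Arr C \<Longrightarrow> \<exists>k. is_kernel C k f"
    and ex_cokernel: "f \<in> Arr C \<Longrightarrow> \<exists>c. is_cokernel C c f"

locale quasi_abelian_category = pre_abelian_category +
  assumes cokernel_pullback_stable:
      "\<lbrakk>is_pullback C f g p q; \<exists>h. is_cokernel C g h\<rbrakk> \<Longrightarrow> \<exists>h. is_cokernel C p h"
    and kernel_pushout_stable:
      "\<lbrakk>is_pushout C f g p q; \<exists>h. is_kernel C g h\<rbrakk> \<Longrightarrow> \<exists>h. is_kernel C p h"


section \<open>Torsion pairs\<close>

text \<open>A full subcategory is given by its set of objects.\<close>

definition iso_closed :: "('o, 'm, 'z) add_cat_scheme \<Rightarrow> 'o set \<Rightarrow> bool" where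
  "iso_closed C S \<longleftrightarrow> S \<subseteq> Obj C \<and> (\<forall>X \<in> S. \<forall>Y \<in> Obj C. isomorphic C X Y \<longrightarrow> Y \<in> S)"

definition torsion_sequence ::
    "('o, 'm, 'z) add_cat_scheme \<Rightarrow> 'o set \<Rightarrow> 'o set \<Rightarrow> 'o \<Rightarrow> 'm \<Rightarrow> 'm \<Rightarrow> bool" where
  "torsion_sequence C T F M f g \<longleftrightarrow>
     short_exact C f g \<and> Cod C f = M \<and> Dom C f \<in> T \<and> Cod C g \<in> F"

definition torsion_pair :: "('o, 'm, 'z) add_cat_scheme \<Rightarrow> 'o set \<Rightarrow> 'o set \<Rightarrow> bool" where
  "torsion_pair C T F \<longleftrightarrow> iso_closed C T \<and> iso_closed C F \<and>
     (\<forall>X \<in> T. \<forall>Y \<in> F. Hom C X Y = {Zero C X Y}) \<and>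
     (\<forall>M \<in> Obj C. \<exists>f g. torsion_sequence C T F M f g)"

definition torsion_class :: "('o, 'm, 'z) add_cat_scheme \<Rightarrow> 'o set \<Rightarrow> bool" where
  "torsion_class C T \<longleftrightarrow> (\<exists>F. torsion_pair C T F)"

text \<open>In a pre-abelian category the torsionfree class is determined by the torsion class.\<close>

definition torsionfree_class :: "('o, 'm, 'z) add_cat_scheme \<Rightarrow> 'o set \<Rightarrow> 'o set" where
  "torsionfree_class C T = (THE F. torsion_pair C T F)"

text \<open>
  The torsion subobject of \<open>M\<close> is only determined up to isomorphism over \<open>M\<close>, so it is
  treated as a predicate on its inclusion into \<open>M\<close>.
\<close>

definition torsion_subobject ::
    "('o, 'm, 'z) add_cat_scheme \<Rightarrow> 'o set \<Rightarrow> 'o \<Rightarrow> 'm \<Rightarrow> bool" where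
  "torsion_subobject C T M t \<longleftrightarrow> (\<exists>g. torsion_sequence C T (torsionfree_class C T) M t g)"

definition subobject_le :: "('o, 'm, 'z) add_cat_scheme \<Rightarrow> 'm \<Rightarrow> 'm \<Rightarrow> bool" where
  "subobject_le C a b \<longleftrightarrow> (\<exists>u \<in> Hom C (Dom C a) (Dom C b). b \<cdot>\<^bsub>C\<^esub> u = a)"

definition torsion_subobject_le ::
    "('o, 'm, 'z) add_cat_scheme \<Rightarrow> 'o set \<Rightarrow> 'o set \<Rightarrow> 'o \<Rightarrow> bool" where
  "torsion_subobject_le C T T' M \<longleftrightarrow>
     (\<forall>t t'. torsion_subobject C T M t \<longrightarrow> torsion_subobject C T' M t' \<longrightarrow> subobject_le C t t')"


section \<open>Chains of torsion classes\<close>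

text \<open>Only the values of a chain on the interval from 0 to 1 are relevant.\<close>

definition torsion_chain :: "('o, 'm, 'z) add_cat_scheme \<Rightarrow> (real \<Rightarrow> 'o set) \<Rightarrow> bool" where
  "torsion_chain C \<eta> \<longleftrightarrow>
     (\<forall>i \<in> {0..1}. torsion_class C (\<eta> i)) \<and> antimono_on {0..1} \<eta> \<and>
     \<eta> 0 = Obj C \<and> \<eta> 1 = {X. zero_object C X}"

definition quasi_Noetherian :: "('o, 'm, 'z) add_cat_scheme \<Rightarrow> (real \<Rightarrow> 'o set) \<Rightarrow> bool" where
  "quasi_Noetherian C \<eta> \<longleftrightarrow>
     (\<forall>a b. 0 \<le> a \<and> a < b \<and> b \<le> 1 \<longrightarrow>
        (\<exists>s \<in> {a<..<b}. \<forall>r \<in> {a<..<b}. \<forall>M \<in> Obj C. torsion_subobject_le C (\<eta> r) (\<eta> s) M))"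

definition weakly_Artinian :: "('o, 'm, 'z) add_cat_scheme \<Rightarrow> (real \<Rightarrow> 'o set) \<Rightarrow> bool" where
  "weakly_Artinian C \<eta> \<longleftrightarrow>
     (\<forall>a b. 0 \<le> a \<and> a < b \<and> b \<le> 1 \<longrightarrow>
        (\<exists>s \<in> {a<..<b}. \<forall>r \<in> {a<..<b}. \<forall>M \<in> Obj C. torsion_subobject_le C (\<eta> s) (\<eta> r) M))"

definition torsion_chains :: "('o, 'm, 'z) add_cat_scheme \<Rightarrow> (real \<Rightarrow> 'o set) set" where
  "torsion_chains C = {\<eta>. torsion_chain C \<eta> \<and> quasi_Noetherian C \<eta> \<and> weakly_Artinian C \<eta>}"

definition slice :: "('o, 'm, 'z) add_cat_scheme \<Rightarrow> (real \<Rightarrow> 'o set) \<Rightarrow> real \<Rightarrow> 'o set" where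
  "slice C \<eta> r =
     (if r = 0 then (\<Inter>s \<in> {0<..1}. torsionfree_class C (\<eta> s))
      else if r = 1 then (\<Inter>s \<in> {0..<1}. \<eta> s)
      else (\<Inter>s \<in> {0..<r}. \<eta> s) \<inter> (\<Inter>s \<in> {r<..1}. torsionfree_class C (\<eta> s)))"


section \<open>Harder-Narasimhan filtrations\<close>

text \<open>
  The arrow \<open>\<iota> k\<close> is the inclusion of \<open>X (k - 1)\<close> into \<open>X k\<close> for \<open>1 \<le> k \<le> n\<close>; it is proper
  iff it is not an isomorphism. Values of \<open>X\<close> and \<open>\<iota>\<close> at other indices are irrelevant. The
  case \<open>n = 0\<close> occurs precisely for zero objects.
\<close>

definition filtration ::
    "('o, 'm, 'z) add_cat_scheme \<Rightarrow> 'o \<Rightarrow> nat \<Rightarrow> (nat \<Rightarrow> 'o) \<Rightarrow> (nat \<Rightarrow> 'm) \<Rightarrow> bool" where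
  "filtration C M n X \<iota> \<longleftrightarrow>
     (\<forall>k \<le> n. X k \<in> Obj C) \<and> zero_object C (X 0) \<and> X n = M \<and>
     (\<forall>k \<in> {1..n}. \<iota> k \<in> Hom C (X (k - 1)) (X k) \<and> \<not> is_iso C (\<iota> k) \<and>
        (\<exists>p. short_exact C (\<iota> k) p))"

definition HN_filtration ::
    "('o, 'm, 'z) add_cat_scheme \<Rightarrow> (real \<Rightarrow> 'o set) \<Rightarrow> 'o \<Rightarrow> nat \<Rightarrow> (nat \<Rightarrow> 'o) \<Rightarrow> (nat \<Rightarrow> 'm) \<Rightarrow> bool"
  where
  "HN_filtration C \<eta> M n X \<iota> \<longleftrightarrow> filtration C M n X \<iota> \<and>
     (\<exists>r. (\<forall>k \<in> {1..n}. r k \<in> {0..1}) \<and>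
          (\<forall>k \<in> {1..n}. \<forall>p. is_cokernel C p (\<iota> k) \<longrightarrow> Cod C p \<in> slice C \<eta> (r k)) \<and>
          (\<forall>k \<in> {1..n}. \<forall>k' \<in> {1..n}. r k > r k' \<longleftrightarrow> k < k'))"

text \<open>
  Isomorphism of filtrations of the same object \<open>M\<close> is isomorphism over \<open>M\<close>, i.e. equality
  of the two chains of subobjects of \<open>M\<close>.
\<close>

definition filtrations_isomorphic ::
    "('o, 'm, 'z) add_cat_scheme \<Rightarrow> 'o \<Rightarrow> nat \<Rightarrow> (nat \<Rightarrow> 'o) \<Rightarrow> (nat \<Rightarrow> 'm) \<Rightarrow>
     nat \<Rightarrow> (nat \<Rightarrow> 'o) \<Rightarrow> (nat \<Rightarrow> 'm) \<Rightarrow> bool" where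
  "filtrations_isomorphic C M n X \<iota> n' X' \<iota>' \<longleftrightarrow> n = n' \<and>
     (\<exists>\<phi>. (\<forall>k \<le> n. \<phi> k \<in> Hom C (X k) (X' k) \<and> is_iso C (\<phi> k)) \<and>
          (\<forall>k \<in> {1..n}. \<phi> k \<cdot>\<^bsub>C\<^esub> \<iota> k = \<iota>' k \<cdot>\<^bsub>C\<^esub> \<phi> (k - 1)) \<and>
          \<phi> n = Id C M)"

end

theory Submission
  imports Defs
begin

text \<open>
  The filtration is built and recognised from its top quotient downwards: the penultimate term
  is the torsion subobject with respect to a torsion class of the chain, taken just above the
  smallest slope. So each step of the argument concerns a single short exact sequence.

  \<^emph>\<open>Finiteness.\<close> The two chain conditions say that the family of torsion classes is
  constant just to the right and just to the left of every point of the unit interval (lemmas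
  \<open>chain_constant_right\<close> and \<open>chain_constant_left\<close>). Hence it is a step function with finitely
  many jumps, although the proof only uses this in the form of a descent along the interval.

  \<^emph>\<open>Existence.\<close> Say that \<open>x\<close> is good if every object lying in \<open>\<eta> s\<close> for all \<open>s < x\<close> has a
  filtration whose slopes are all at least \<open>x\<close>. The point 1 is good. If \<open>\<eta>\<close> is constant on
  \<open>(x, s]\<close> and \<open>s\<close> is good, then so is \<open>x\<close> (lemma \<open>HN_from_step_left\<close>): unless \<open>M\<close> is itself torsion
  at \<open>s\<close>, its torsion sequence at \<open>s\<close> splits off a quotient in the slice at \<open>x\<close>, and the torsion
  part is filtered because \<open>s\<close> is good.
  If \<open>\<eta>\<close> is constant on an interval \<open>[\<sigma>, x)\<close> and \<open>x\<close> is good, then the points of \<open>(\<sigma>, x)\<close> are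
  good, since being torsion on a part of the interval already means being torsion up to \<open>x\<close>.
  So the infimum of the good points is good and cannot be positive; it is 0, where goodness is
  the claim for all objects.

  \<^emph>\<open>Uniqueness.\<close> Torsion classes are closed under extensions, so an object with a filtration
  is torsion for all \<open>s\<close> below its smallest slope, while its top quotient is torsionfree for all
  \<open>s\<close> above that slope. Comparing two filtrations therefore forces the smallest slopes to agree,
  and the penultimate terms map into each other since the next larger slopes are separated from
  the smallest one by some \<open>s\<close> (lemma \<open>HN_iso_penultimate\<close>). Induction on the length finishes the argument.
\<close>

section \<open>Zero morphisms, kernels and cokernels\<close>

context category
begin

lemma Hom_Obj:
  assumes "f \<in> Hom C X Y"
  shows "X \<in> Obj C" "Y \<in> Obj C"
  using assms Dom_in_Obj Cod_in_Obj by (auto simp: Hom_def)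

lemma is_iso_iff_inverse:
  assumes "f \<in> Hom C X Y"
  shows "is_iso C f \<longleftrightarrow> (\<exists>g \<in> Hom C Y X. g \<cdot> f = Id C X \<and> f \<cdot> g = Id C Y)"
  using assms by (auto simp: is_iso_def Hom_def)

lemma iso_inverse:
  assumes "f \<in> Hom C X Y" "is_iso C f"
  obtains g where "g \<in> Hom C Y X" "is_iso C g" "g \<cdot> f = Id C X" "f \<cdot> g = Id C Y"
  using assms is_iso_iff_inverse by metis

lemma iso_closedD:
  assumes "iso_closed C S" "X \<in> S" "f \<in> Hom C X Y" "is_iso C f"
  shows "Y \<in> S"
  using assms Hom_Obj unfolding iso_closed_def isomorphic_def by blast

end

lemma kernel_Hom:
  assumes "is_kernel C k f"
  shows "k \<in> Hom C (Dom C k) (Dom C f)" "f \<in> Hom C (Dom C f) (Cod C f)"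
  using assms by (auto simp: is_kernel_def Hom_def)

lemma cokernel_Hom:
  assumes "is_cokernel C c f"
  shows "c \<in> Hom C (Cod C f) (Cod C c)" "f \<in> Hom C (Dom C f) (Cod C f)"
  using assms by (auto simp: is_cokernel_def Hom_def)

lemma kernel_comp:
  assumes "is_kernel C k f" "k \<in> Hom C X Y" "f \<in> Hom C Y Z"
  shows "f \<cdot>\<^bsub>C\<^esub> k = Zero C X Z"
  using assms by (auto simp: is_kernel_def Hom_def)

lemma cokernel_comp:
  assumes "is_cokernel C c f" "f \<in> Hom C X Y" "c \<in> Hom C Y Z"
  shows "c \<cdot>\<^bsub>C\<^esub> f = Zero C X Z"
  using assms by (auto simp: is_cokernel_def Hom_def)

lemma kernel_lift:
  assumes "is_kernel C k f" "k \<in> Hom C X Y" "f \<in> Hom C Y Z"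
    and "h \<in> Hom C W Y" "f \<cdot>\<^bsub>C\<^esub> h = Zero C W Z"
  obtains u where "u \<in> Hom C W X" "k \<cdot>\<^bsub>C\<^esub> u = h"
proof -
  have "Dom C k = X" "Dom C f = Y" "Cod C f = Z"
    using assms by (auto simp: Hom_def)
  then show thesis
    using assms that unfolding is_kernel_def by blast
qed

lemma cokernel_extend:
  assumes "is_cokernel C c f" "f \<in> Hom C X Y" "c \<in> Hom C Y Z"
    and "h \<in> Hom C Y W" "h \<cdot>\<^bsub>C\<^esub> f = Zero C X W"
  obtains u where "u \<in> Hom C Z W" "u \<cdot>\<^bsub>C\<^esub> c = h"
proof -
  have "Cod C c = Z" "Dom C f = X" "Cod C f = Y"
    using assms by (auto simp: Hom_def)
  then show thesis
    using assms that unfolding is_cokernel_def by blast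
qed

context preadditive_category
begin

lemma Zero_in_Hom:
  assumes "X \<in> Obj C" "Y \<in> Obj C"
  shows "Zero C X Y \<in> Hom C X Y"
proof -
  interpret comm_group "Hom_group C X Y"
    using Hom_comm_group assms .
  show ?thesis
    using one_closed by (simp add: Hom_group_def)
qed

lemma idempotent_sum_is_Zero:
  assumes "f \<in> Hom C X Y" "Plus C f f = f"
  shows "f = Zero C X Y"
proof -
  interpret comm_group "Hom_group C X Y"
    using Hom_comm_group Hom_Obj assms by blast
  show ?thesis
    using assms r_cancel_one[of f f] by (simp add: Hom_group_def)
qed

lemma Plus_Zero_Zero:
  assumes "X \<in> Obj C" "Y \<in> Obj C"
  shows "Plus C (Zero C X Y) (Zero C X Y) = Zero C X Y"
proof -
  interpret comm_group "Hom_group C X Y"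
    using Hom_comm_group assms .
  show ?thesis
    using r_one[OF one_closed] by (simp add: Hom_group_def)
qed

lemma Comp_Zero:
  assumes "h \<in> Hom C Y Z" "X \<in> Obj C"
  shows "h \<cdot> Zero C X Y = Zero C X Z"
proof (rule idempotent_sum_is_Zero)
  have Y: "Y \<in> Obj C"
    using Hom_Obj assms by blast
  note zero = Zero_in_Hom[OF assms(2) Y]
  show "h \<cdot> Zero C X Y \<in> Hom C X Z"
    using Comp_in_Hom zero assms by blast
  show "Plus C (h \<cdot> Zero C X Y) (h \<cdot> Zero C X Y) = h \<cdot> Zero C X Y"
    using Comp_Plus[OF zero zero assms(1)] Plus_Zero_Zero assms(2) Y by simp
qed

lemma Zero_Comp:
  assumes "f \<in> Hom C X Y" "Z \<in> Obj C"
  shows "Zero C Y Z \<cdot> f = Zero C X Z"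
proof (rule idempotent_sum_is_Zero)
  have Y: "Y \<in> Obj C"
    using Hom_Obj assms by blast
  note zero = Zero_in_Hom[OF Y assms(2)]
  show "Zero C Y Z \<cdot> f \<in> Hom C X Z"
    using Comp_in_Hom zero assms by blast
  show "Plus C (Zero C Y Z \<cdot> f) (Zero C Y Z \<cdot> f) = Zero C Y Z \<cdot> f"
    using Plus_Comp[OF assms(1) zero zero] Plus_Zero_Zero assms(2) Y by simp
qed

lemma from_zero_object:
  assumes "zero_object C X" "f \<in> Hom C X Y"
  shows "f = Zero C X Y"
  using assms Hom_Obj Zero_in_Hom unfolding zero_object_def by metis

lemma to_zero_object:
  assumes "zero_object C Y" "f \<in> Hom C X Y"
  shows "f = Zero C X Y"
  using assms Hom_Obj Zero_in_Hom unfolding zero_object_def by metis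

lemma kernel_mono:
  assumes "is_kernel C k f" "k \<in> Hom C X Y" "a \<in> Hom C W X" "b \<in> Hom C W X" "k \<cdot> a = k \<cdot> b"
  shows "a = b"
proof -
  have f: "f \<in> Hom C Y (Cod C f)" and X: "Dom C k = X" and Y: "Dom C f = Y"
    using assms by (auto simp: is_kernel_def Hom_def)
  have ka: "k \<cdot> a \<in> Hom C W Y"
    using Comp_in_Hom assms by blast
  have "f \<cdot> (k \<cdot> a) = (f \<cdot> k) \<cdot> a"
    using Comp_assoc[OF assms(3,2) f] by simp
  also have "\<dots> = Zero C W (Cod C f)"
    using kernel_comp[OF assms(1,2) f] Zero_Comp assms(3) Hom_Obj(2)[OF f] by simp
  finally have "\<exists>!u. u \<in> Hom C W X \<and> k \<cdot> u = k \<cdot> a"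
    using assms(1) ka X Y unfolding is_kernel_def by metis
  then show ?thesis
    using assms by metis
qed

lemma cokernel_epi:
  assumes "is_cokernel C c f" "c \<in> Hom C Y Z" "a \<in> Hom C Z W" "b \<in> Hom C Z W" "a \<cdot> c = b \<cdot> c"
  shows "a = b"
proof -
  have f: "f \<in> Hom C (Dom C f) Y" and Z: "Cod C c = Z" and Y: "Cod C f = Y"
    using assms by (auto simp: is_cokernel_def Hom_def)
  have ac: "a \<cdot> c \<in> Hom C Y W"
    using Comp_in_Hom assms by blast
  have "(a \<cdot> c) \<cdot> f = a \<cdot> (c \<cdot> f)"
    using Comp_assoc[OF f assms(2,3)] .
  also have "\<dots> = Zero C (Dom C f) W"
    using cokernel_comp[OF assms(1) f assms(2)] Comp_Zero assms(3) Hom_Obj(1)[OF f] by simp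
  finally have "\<exists>!u. u \<in> Hom C Z W \<and> u \<cdot> c = a \<cdot> c"
    using assms(1) ac Y Z unfolding is_cokernel_def by metis
  then show ?thesis
    using assms by metis
qed

lemma kernel_of_Zero_is_iso:
  assumes "is_kernel C k (Zero C Y Z)" "k \<in> Hom C X Y" "Z \<in> Obj C"
  shows "is_iso C k"
proof -
  have X: "X \<in> Obj C" and Y: "Y \<in> Obj C"
    using Hom_Obj assms by blast+
  obtain u where u: "u \<in> Hom C Y X" "k \<cdot> u = Id C Y"
    using kernel_lift[OF assms(1,2) Zero_in_Hom[OF Y assms(3)] Id_in_Hom[OF Y]
        Zero_Comp[OF Id_in_Hom[OF Y] assms(3)]] .
  have "k \<cdot> (u \<cdot> k) = k \<cdot> Id C X"
    using Comp_assoc[OF assms(2) u(1) assms(2)] u Id_Comp Comp_Id assms(2) by simp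
  then have "u \<cdot> k = Id C X"
    using kernel_mono[OF assms(1,2)] Comp_in_Hom u(1) assms(2) Id_in_Hom X by blast
  then show ?thesis
    using u is_iso_iff_inverse[OF assms(2)] by blast
qed

lemma cokernel_of_Zero_is_iso:
  assumes "is_cokernel C c (Zero C X Y)" "c \<in> Hom C Y Z" "X \<in> Obj C"
  shows "is_iso C c"
proof -
  have Y: "Y \<in> Obj C" and Z: "Z \<in> Obj C"
    using Hom_Obj assms by blast+
  obtain u where u: "u \<in> Hom C Z Y" "u \<cdot> c = Id C Y"
    using cokernel_extend[OF assms(1) Zero_in_Hom[OF assms(3) Y] assms(2) Id_in_Hom[OF Y]
        Comp_Zero[OF Id_in_Hom[OF Y] assms(3)]] .
  have "(c \<cdot> u) \<cdot> c = Id C Z \<cdot> c"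
    using Comp_assoc[OF assms(2) u(1) assms(2)] u Id_Comp Comp_Id assms(2) by simp
  then have "c \<cdot> u = Id C Z"
    using cokernel_epi[OF assms(1,2)] Comp_in_Hom u(1) assms(2) Id_in_Hom Z by blast
  then show ?thesis
    using u is_iso_iff_inverse[OF assms(2)] by blast
qed

lemma cokernel_unique:
  assumes "is_cokernel C c f" "is_cokernel C c' f"
  obtains u where "u \<in> Hom C (Cod C c) (Cod C c')" "is_iso C u"
proof -
  note c = cokernel_Hom(1)[OF assms(1)] and c' = cokernel_Hom(1)[OF assms(2)]
  note f = cokernel_Hom(2)[OF assms(1)]
  obtain u where u: "u \<in> Hom C (Cod C c) (Cod C c')" "u \<cdot> c = c'"
    using cokernel_extend[OF assms(1) f c c' cokernel_comp[OF assms(2) f c']] .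
  obtain v where v: "v \<in> Hom C (Cod C c') (Cod C c)" "v \<cdot> c' = c"
    using cokernel_extend[OF assms(2) f c' c cokernel_comp[OF assms(1) f c]] .
  have "(v \<cdot> u) \<cdot> c = Id C (Cod C c) \<cdot> c"
    using Comp_assoc[OF c u(1) v(1)] u v Id_Comp[OF c] by simp
  then have "v \<cdot> u = Id C (Cod C c)"
    using cokernel_epi[OF assms(1) c Comp_in_Hom[OF u(1) v(1)] Id_in_Hom[OF Hom_Obj(2)[OF c]]]
    by blast
  moreover have "(u \<cdot> v) \<cdot> c' = Id C (Cod C c') \<cdot> c'"
    using Comp_assoc[OF c' v(1) u(1)] u v Id_Comp[OF c'] by simp
  then have "u \<cdot> v = Id C (Cod C c')"
    using cokernel_epi[OF assms(2) c' Comp_in_Hom[OF v(1) u(1)] Id_in_Hom[OF Hom_Obj(2)[OF c']]]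
    by blast
  ultimately show thesis
    using that u(1) v(1) is_iso_iff_inverse[OF u(1)] by blast
qed

lemma short_exact_from_zero_object:
  assumes "zero_object C Z" "M \<in> Obj C"
  shows "short_exact C (Zero C Z M) (Id C M)"
proof -
  have Z: "Z \<in> Obj C"
    using assms unfolding zero_object_def by blast
  note zero = Zero_in_Hom[OF Z assms(2)] and id = Id_in_Hom[OF assms(2)]
  have dc: "Dom C (Zero C Z M) = Z" "Cod C (Zero C Z M) = M" "Zero C Z M \<in> Arr C"
      "Dom C (Id C M) = M" "Cod C (Id C M) = M" "Id C M \<in> Arr C"
    using zero id by (auto simp: Hom_def)
  have "is_kernel C (Zero C Z M) (Id C M)"
    unfolding is_kernel_def dc
  proof (intro conjI allI ballI impI)
    show "Id C M \<cdot> Zero C Z M = Zero C Z M"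
      using Id_Comp zero .
  next
    fix W h
    assume h: "h \<in> Hom C W M" "Id C M \<cdot> h = Zero C W M"
    have W: "W \<in> Obj C"
      using Hom_Obj(1)[OF h(1)] .
    have "Zero C Z M \<cdot> Zero C W Z = h"
      using h(2) Id_Comp[OF h(1)] Comp_Zero[OF zero W] by simp
    then show "\<exists>!u. u \<in> Hom C W Z \<and> Zero C Z M \<cdot> u = h"
      using Zero_in_Hom[OF W Z] by (auto dest: to_zero_object[OF assms(1)])
  qed (use dc in simp_all)
  moreover have "is_cokernel C (Id C M) (Zero C Z M)"
    unfolding is_cokernel_def dc
  proof (intro conjI allI ballI impI)
    show "Id C M \<cdot> Zero C Z M = Zero C Z M"
      using Id_Comp zero .
  next
    fix W h
    assume h: "h \<in> Hom C M W"
    then show "\<exists>!u. u \<in> Hom C M W \<and> u \<cdot> Id C M = h"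
      using Comp_Id[OF h(1)] by (intro ex1I conjI) (auto simp: Comp_Id[of _ M W])
  qed (use dc in simp_all)
  ultimately show ?thesis
    by (simp add: short_exact_def)
qed

lemma short_exact_Hom:
  assumes "short_exact C f g"
  shows "f \<in> Hom C (Dom C f) (Cod C f)" "g \<in> Hom C (Cod C f) (Cod C g)"
  using assms cokernel_Hom[of C g f] unfolding short_exact_def by simp_all

lemma zero_object_iff_Id_eq_Zero:
  assumes "X \<in> Obj C"
  shows "zero_object C X \<longleftrightarrow> Id C X = Zero C X X"
proof
  assume "zero_object C X"
  then show "Id C X = Zero C X X"
    using from_zero_object Id_in_Hom assms by blast
next
  assume id: "Id C X = Zero C X X"
  have "f = Zero C X Y" if "f \<in> Hom C X Y" for f Y
    using that id Comp_Id Comp_Zero assms by metis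
  moreover have "f = Zero C Y X" if "f \<in> Hom C Y X" for f Y
    using that id Id_Comp Zero_Comp assms by metis
  ultimately show "zero_object C X"
    using assms Zero_in_Hom unfolding zero_object_def by metis
qed

lemma zero_object_subobject:
  assumes "is_kernel C k f" "k \<in> Hom C X Y" "zero_object C Y"
  shows "is_iso C k"
proof -
  have Y: "Dom C f = Y"
    using assms by (auto simp: is_kernel_def Hom_def)
  have f: "f \<in> Hom C Y (Cod C f)"
    using kernel_Hom(2)[OF assms(1)] Y by simp
  have "is_kernel C k (Zero C Y (Cod C f))"
    using assms(1) from_zero_object[OF assms(3) f] by simp
  then show ?thesis
    using kernel_of_Zero_is_iso[OF _ assms(2) Hom_Obj(2)[OF f]] by blast
qed

lemma zero_object_iso:
  assumes "zero_object C X" "f \<in> Hom C X Y" "is_iso C f"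
  shows "zero_object C Y"
proof -
  obtain g where g: "g \<in> Hom C Y X" "f \<cdot> g = Id C Y"
    using iso_inverse[OF assms(2,3)] .
  have Y: "Y \<in> Obj C"
    using Hom_Obj assms by blast
  have "Id C Y = Zero C Y Y"
    using g from_zero_object[OF assms(1,2)] Zero_Comp Y by metis
  then show ?thesis
    using zero_object_iff_Id_eq_Zero Y by blast
qed


section \<open>Torsion pairs\<close>

lemma torsion_pair_Hom_Zero:
  assumes "torsion_pair C T F" "X \<in> T" "Y \<in> F" "f \<in> Hom C X Y"
  shows "f = Zero C X Y"
  using assms unfolding torsion_pair_def by blast

lemma torsion_pair_Obj:
  assumes "torsion_pair C T F"
  shows "X \<in> T \<Longrightarrow> X \<in> Obj C" "Y \<in> F \<Longrightarrow> Y \<in> Obj C"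
  using assms unfolding torsion_pair_def iso_closed_def by blast+

lemma torsion_iso_closed:
  assumes "torsion_pair C T F" "X \<in> T" "f \<in> Hom C X Y" "is_iso C f"
  shows "Y \<in> T"
  using iso_closedD[OF _ assms(2-4)] assms(1) unfolding torsion_pair_def by blast

lemma torsionfree_iso_closed:
  assumes "torsion_pair C T F" "X \<in> F" "f \<in> Hom C X Y" "is_iso C f"
  shows "Y \<in> F"
  using iso_closedD[OF _ assms(2-4)] assms(1) unfolding torsion_pair_def by blast

lemma torsion_pair_sequence:
  assumes "torsion_pair C T F" "M \<in> Obj C"
  obtains f g X Y where "short_exact C f g"
    "f \<in> Hom C X M" "g \<in> Hom C M Y" "X \<in> T" "Y \<in> F"
proof -
  obtain f g where fg: "torsion_sequence C T F M f g"
    using assms unfolding torsion_pair_def by blast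
  then have "short_exact C f g" "f \<in> Hom C (Dom C f) M" "g \<in> Hom C M (Cod C g)"
      "Dom C f \<in> T" "Cod C g \<in> F"
    using short_exact_Hom[of f g] unfolding torsion_sequence_def by auto
  then show thesis
    using that by blast
qed

text \<open>
  Each half of a torsion pair is the orthogonal of the other: for \<open>Y\<close> in the right orthogonal
  of \<open>T\<close>, the inclusion of the torsion part of \<open>Y\<close> vanishes, so that \<open>Y\<close> is isomorphic to its
  torsionfree part.
\<close>

lemma torsionfree_iff:
  assumes "torsion_pair C T F"
  shows "Y \<in> F \<longleftrightarrow> Y \<in> Obj C \<and> (\<forall>X \<in> T. Hom C X Y \<subseteq> {Zero C X Y})"
proof (intro iffI conjI)
  assume "Y \<in> F"
  then show "Y \<in> Obj C" "\<forall>X \<in> T. Hom C X Y \<subseteq> {Zero C X Y}"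
    using torsion_pair_Obj(2)[OF assms] assms unfolding torsion_pair_def by auto
next
  assume Y: "Y \<in> Obj C \<and> (\<forall>X \<in> T. Hom C X Y \<subseteq> {Zero C X Y})"
  obtain f g T' F' where fg: "short_exact C f g" "f \<in> Hom C T' Y" "g \<in> Hom C Y F'"
      "T' \<in> T" "F' \<in> F"
    using torsion_pair_sequence[OF assms conjunct1[OF Y]] .
  have "f = Zero C T' Y"
    using Y fg(2,4) by blast
  then have "is_iso C g"
    using cokernel_of_Zero_is_iso[OF _ fg(3) Hom_Obj(1)[OF fg(2)]] fg(1)
    unfolding short_exact_def by simp
  then obtain g' where "g' \<in> Hom C F' Y" "is_iso C g'"
    by (rule iso_inverse[OF fg(3)])
  then show "Y \<in> F"
    using torsionfree_iso_closed[OF assms fg(5)] by blast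
qed

lemma torsion_iff:
  assumes "torsion_pair C T F"
  shows "X \<in> T \<longleftrightarrow> X \<in> Obj C \<and> (\<forall>Y \<in> F. Hom C X Y \<subseteq> {Zero C X Y})"
proof (intro iffI conjI)
  assume "X \<in> T"
  then show "X \<in> Obj C" "\<forall>Y \<in> F. Hom C X Y \<subseteq> {Zero C X Y}"
    using torsion_pair_Obj(1)[OF assms] assms unfolding torsion_pair_def by auto
next
  assume X: "X \<in> Obj C \<and> (\<forall>Y \<in> F. Hom C X Y \<subseteq> {Zero C X Y})"
  obtain f g T' F' where fg: "short_exact C f g" "f \<in> Hom C T' X" "g \<in> Hom C X F'"
      "T' \<in> T" "F' \<in> F"
    using torsion_pair_sequence[OF assms conjunct1[OF X]] .
  have "g = Zero C X F'"
    using X fg(3,5) by blast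
  then have "is_iso C f"
    using kernel_of_Zero_is_iso[OF _ fg(2) Hom_Obj(2)[OF fg(3)]] fg(1)
    unfolding short_exact_def by simp
  then show "X \<in> T"
    using torsion_iso_closed[OF assms fg(4,2)] by blast
qed

lemma torsion_pair_torsionfree_class:
  assumes "torsion_class C T"
  shows "torsion_pair C T (torsionfree_class C T)"
proof -
  obtain F where F: "torsion_pair C T F"
    using assms unfolding torsion_class_def by blast
  have "F' = F" if "torsion_pair C T F'" for F'
    by (rule Set.set_eqI) (simp only: torsionfree_iff[OF that] torsionfree_iff[OF F])
  then show ?thesis
    unfolding torsionfree_class_def using F by (rule theI[rotated])
qed

lemma zero_object_torsion:
  assumes "torsion_pair C T F" "zero_object C X"
  shows "X \<in> T"
proof -
  have "X \<in> Obj C"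
    using assms(2) unfolding zero_object_def by blast
  then show ?thesis
    using torsion_iff[OF assms(1)] by (auto dest: from_zero_object[OF assms(2)])
qed

lemma torsion_quotient:
  assumes "torsion_pair C T F" "is_cokernel C c f" "c \<in> Hom C Y Z" "Y \<in> T"
  shows "Z \<in> T"
proof -
  have "h = Zero C Z W" if "W \<in> F" "h \<in> Hom C Z W" for h W
  proof (rule cokernel_epi[OF assms(2,3)])
    have W: "W \<in> Obj C"
      using Hom_Obj(2)[OF that(2)] .
    show "Zero C Z W \<in> Hom C Z W"
      using Zero_in_Hom Hom_Obj[OF that(2)] .
    show "h \<cdot> c = Zero C Z W \<cdot> c"
      using torsion_pair_Hom_Zero[OF assms(1,4) that(1) Comp_in_Hom[OF assms(3) that(2)]]
        Zero_Comp[OF assms(3) W] by simp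
  qed (fact that)
  then show ?thesis
    using torsion_iff[OF assms(1)] Hom_Obj(2)[OF assms(3)] by auto
qed

lemma torsion_extension:
  assumes "torsion_pair C T F" "is_cokernel C g f" "f \<in> Hom C X Y" "g \<in> Hom C Y Z"
    and "X \<in> T" "Z \<in> T"
  shows "Y \<in> T"
proof -
  have "h = Zero C Y W" if W: "W \<in> F" and h: "h \<in> Hom C Y W" for h W
  proof -
    have "h \<cdot> f = Zero C X W"
      using torsion_pair_Hom_Zero[OF assms(1,5) W Comp_in_Hom[OF assms(3) h]] .
    then obtain u where u: "u \<in> Hom C Z W" "u \<cdot> g = h"
      using cokernel_extend[OF assms(2,3,4) h] by blast
    have "u = Zero C Z W"
      using torsion_pair_Hom_Zero[OF assms(1,6) W u(1)] .
    then show ?thesis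
      using u Zero_Comp[OF assms(4)] Hom_Obj(2)[OF h] by simp
  qed
  then show ?thesis
    using torsion_iff[OF assms(1)] Hom_Obj(2)[OF assms(3)] by auto
qed

text \<open>
  For \<open>X \<in> T\<close> the torsion subobject of \<open>X\<close> with respect to \<open>T\<close> is all of \<open>X\<close>, so the hypothesis
  makes the inclusion of the torsion subobject with respect to \<open>T'\<close> a split epimorphism; a
  morphism from \<open>X\<close> to a torsionfree object then vanishes already on that subobject.
\<close>

lemma torsion_subset_of_subobject_le:
  assumes T: "torsion_class C T" and T': "torsion_class C T'"
    and le: "\<And>M. M \<in> Obj C \<Longrightarrow> torsion_subobject_le C T T' M"
  shows "T \<subseteq> T'"
proof
  fix X
  assume X: "X \<in> T"
  note pair = torsion_pair_torsionfree_class[OF T] and pair' = torsion_pair_torsionfree_class[OF T']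
  have XO: "X \<in> Obj C"
    using torsion_pair_Obj(1)[OF pair X] .
  obtain t g A B where t: "short_exact C t g" "t \<in> Hom C A X" "g \<in> Hom C X B"
      "A \<in> T" "B \<in> torsionfree_class C T"
    using torsion_pair_sequence[OF pair XO] .
  obtain t' g' A' B' where t': "short_exact C t' g'" "t' \<in> Hom C A' X" "g' \<in> Hom C X B'"
      "A' \<in> T'" "B' \<in> torsionfree_class C T'"
    using torsion_pair_sequence[OF pair' XO] .
  have "torsion_sequence C T (torsionfree_class C T) X t g"
      "torsion_sequence C T' (torsionfree_class C T') X t' g'"
    using t t' by (auto simp: torsion_sequence_def Hom_def)
  then have "torsion_subobject C T X t" "torsion_subobject C T' X t'"
    unfolding torsion_subobject_def by blast+
  have "subobject_le C t t'"
    using le[OF XO] \<open>torsion_subobject C T X t\<close> \<open>torsion_subobject C T' X t'\<close>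
    unfolding torsion_subobject_le_def by blast
  then obtain v where v: "v \<in> Hom C A A'" "t' \<cdot> v = t"
    using t(2) t'(2) unfolding subobject_le_def Hom_def by auto
  have "g \<cdot> Id C X = Zero C X B"
    using torsion_pair_Hom_Zero[OF pair X t(5,3)] Comp_Id[OF t(3)] by simp
  then obtain u where u: "u \<in> Hom C X A" "t \<cdot> u = Id C X"
    using kernel_lift[OF _ t(2,3) Id_in_Hom[OF XO]] t(1) unfolding short_exact_def by blast
  have vu: "v \<cdot> u \<in> Hom C X A'" "t' \<cdot> (v \<cdot> u) = Id C X"
    using Comp_in_Hom[OF u(1) v(1)] Comp_assoc[OF u(1) v(1) t'(2)] u v by auto
  have "h = Zero C X Y" if "Y \<in> torsionfree_class C T'" "h \<in> Hom C X Y" for h Y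
  proof -
    have "h = (h \<cdot> t') \<cdot> (v \<cdot> u)"
      using vu Comp_assoc[OF vu(1) t'(2) that(2)] Comp_Id[OF that(2)] by simp
    also have "h \<cdot> t' = Zero C A' Y"
      using torsion_pair_Hom_Zero[OF pair' t'(4) that(1) Comp_in_Hom[OF t'(2) that(2)]] .
    finally show ?thesis
      using Zero_Comp[OF vu(1)] Hom_Obj(2)[OF that(2)] by simp
  qed
  then show "X \<in> T'"
    using torsion_iff[OF pair'] XO by auto
qed

end


section \<open>Chains of torsion classes\<close>

locale torsion_chain_category = additive_category +
  fixes \<eta> :: "real \<Rightarrow> 'a set"
  assumes torsion_chain_in: "\<eta> \<in> torsion_chains C"
begin

abbreviation \<F> :: "real \<Rightarrow> 'a set" where
  "\<F> s \<equiv> torsionfree_class C (\<eta> s)"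

lemma chain_torsion_class:
  assumes "s \<in> {0..1}"
  shows "torsion_class C (\<eta> s)"
  using assms torsion_chain_in unfolding torsion_chains_def torsion_chain_def by blast

lemma chain_pair:
  assumes "s \<in> {0..1}"
  shows "torsion_pair C (\<eta> s) (\<F> s)"
  using torsion_pair_torsionfree_class chain_torsion_class assms .

lemma chain_antimono:
  assumes "0 \<le> r" "r \<le> s" "s \<le> 1"
  shows "\<eta> s \<subseteq> \<eta> r"
proof -
  have "antimono_on {0..1} \<eta>"
    using torsion_chain_in unfolding torsion_chains_def torsion_chain_def by blast
  then show ?thesis
    using assms by (auto simp: monotone_on_def)
qed

lemma torsionfree_mono:
  assumes "0 \<le> r" "r \<le> s" "s \<le> 1"
  shows "\<F> r \<subseteq> \<F> s"
proof
  fix Y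
  assume Y: "Y \<in> \<F> r"
  have r01: "r \<in> {0..1}" and s01: "s \<in> {0..1}"
    using assms by auto
  have "Y \<in> Obj C" "\<forall>X \<in> \<eta> r. Hom C X Y \<subseteq> {Zero C X Y}"
    using Y torsionfree_iff[OF chain_pair[OF r01], of Y] by blast+
  then have "\<forall>X \<in> \<eta> s. Hom C X Y \<subseteq> {Zero C X Y}"
    using chain_antimono[OF assms] by blast
  then show "Y \<in> \<F> s"
    using \<open>Y \<in> Obj C\<close> torsionfree_iff[OF chain_pair[OF s01], of Y] by blast
qed

text \<open>
  A point where the torsion subobjects are largest among those over \<open>(x, 1)\<close> has the largest
  torsion class there; by antimonotonicity the classes to its left can only be equal to it.
\<close>

lemma chain_constant_right:
  assumes "0 \<le> x" "x < 1"
  obtains \<sigma> where "x < \<sigma>" "\<sigma> < 1" "\<And>r. x < r \<Longrightarrow> r \<le> \<sigma> \<Longrightarrow> \<eta> r = \<eta> \<sigma>"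
proof -
  have "quasi_Noetherian C \<eta>"
    using torsion_chain_in unfolding torsion_chains_def by blast
  then obtain \<sigma> where \<sigma>: "\<sigma> \<in> {x<..<1}"
      "\<And>r M. r \<in> {x<..<1} \<Longrightarrow> M \<in> Obj C \<Longrightarrow> torsion_subobject_le C (\<eta> r) (\<eta> \<sigma>) M"
    using assms unfolding quasi_Noetherian_def by (meson order_refl)
  have "\<eta> r = \<eta> \<sigma>" if "x < r" "r \<le> \<sigma>" for r
  proof
    show "\<eta> r \<subseteq> \<eta> \<sigma>"
      using that \<sigma> assms chain_torsion_class by (intro torsion_subset_of_subobject_le) auto
    show "\<eta> \<sigma> \<subseteq> \<eta> r"
      using that \<sigma>(1) assms by (intro chain_antimono) auto
  qed
  then show thesis
    using that \<sigma>(1) by auto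
qed

lemma chain_constant_left:
  assumes "0 < x" "x \<le> 1"
  obtains \<sigma> where "0 < \<sigma>" "\<sigma> < x" "\<And>r. \<sigma> \<le> r \<Longrightarrow> r < x \<Longrightarrow> \<eta> r = \<eta> \<sigma>"
proof -
  have "weakly_Artinian C \<eta>"
    using torsion_chain_in unfolding torsion_chains_def by blast
  then obtain \<sigma> where \<sigma>: "\<sigma> \<in> {0<..<x}"
      "\<And>r M. r \<in> {0<..<x} \<Longrightarrow> M \<in> Obj C \<Longrightarrow> torsion_subobject_le C (\<eta> \<sigma>) (\<eta> r) M"
    using assms unfolding weakly_Artinian_def by (meson order_refl)
  have "\<eta> r = \<eta> \<sigma>" if "\<sigma> \<le> r" "r < x" for r
  proof
    show "\<eta> \<sigma> \<subseteq> \<eta> r"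
      using that \<sigma> assms chain_torsion_class by (intro torsion_subset_of_subobject_le) auto
    show "\<eta> r \<subseteq> \<eta> \<sigma>"
      using that \<sigma>(1) assms by (intro chain_antimono) auto
  qed
  then show thesis
    using that \<sigma>(1) by auto
qed

text \<open>At the two endpoints one of the families of conditions is empty, so no case split remains.\<close>

lemma slice_iff:
  assumes "r \<in> {0..1}"
  shows "Y \<in> slice C \<eta> r \<longleftrightarrow> (\<forall>s \<in> {0..<r}. Y \<in> \<eta> s) \<and> (\<forall>s \<in> {r<..1}. Y \<in> \<F> s)"
  using assms by (auto simp: slice_def)

lemma slice_iso_closed:
  assumes "r \<in> {0..1}" "X \<in> slice C \<eta> r" "f \<in> Hom C X Y" "is_iso C f"
  shows "Y \<in> slice C \<eta> r"
proof -
  have "Y \<in> \<eta> s" if "X \<in> \<eta> s" "s \<in> {0..1}" for s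
    using torsion_iso_closed[OF chain_pair that(1) assms(3,4)] that(2) by blast
  moreover have "Y \<in> \<F> s" if "X \<in> \<F> s" "s \<in> {0..1}" for s
    using torsionfree_iso_closed[OF chain_pair that(1) assms(3,4)] that(2) by blast
  ultimately show ?thesis
    using assms(1,2) by (auto simp: slice_iff)
qed


section \<open>Filtrations with prescribed slopes\<close>

text \<open>
  Recording the slopes, and leaving the filtered object \<open>X n\<close> implicit, makes truncation and
  extension of a filtration at its top immediate.
\<close>

definition HN_with_slopes :: "nat \<Rightarrow> (nat \<Rightarrow> 'a) \<Rightarrow> (nat \<Rightarrow> 'b) \<Rightarrow> (nat \<Rightarrow> real) \<Rightarrow> bool" where
  "HN_with_slopes n X \<iota> r \<longleftrightarrow> filtration C (X n) n X \<iota> \<and>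
     (\<forall>k \<in> {1..n}. r k \<in> {0..1}) \<and>
     (\<forall>k \<in> {1..n}. \<forall>p. is_cokernel C p (\<iota> k) \<longrightarrow> Cod C p \<in> slice C \<eta> (r k)) \<and>
     (\<forall>k \<in> {1..n}. \<forall>k' \<in> {1..n}. r k > r k' \<longleftrightarrow> k < k')"

lemma HN_filtration_iff_slopes:
  "HN_filtration C \<eta> M n X \<iota> \<longleftrightarrow> X n = M \<and> (\<exists>r. HN_with_slopes n X \<iota> r)"
  unfolding HN_filtration_def HN_with_slopes_def filtration_def by blast

lemma HN_truncate:
  assumes "HN_with_slopes (Suc m) X \<iota> r"
  shows "HN_with_slopes m X \<iota> r"
  using assms unfolding HN_with_slopes_def filtration_def by auto

lemma HN_bottom:
  assumes "HN_with_slopes n X \<iota> r"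
  shows "zero_object C (X 0)"
  using assms unfolding HN_with_slopes_def filtration_def by auto

lemma HN_slope_bounds:
  assumes "HN_with_slopes n X \<iota> r" "k \<in> {1..n}"
  shows "0 \<le> r k" "r k \<le> 1" "r n \<le> r k"
proof -
  show "0 \<le> r k" "r k \<le> 1"
    using assms unfolding HN_with_slopes_def by auto
  have "\<not> r n > r k"
    using assms unfolding HN_with_slopes_def by auto
  then show "r n \<le> r k"
    by simp
qed

lemma HN_top_sequence:
  assumes "HN_with_slopes (Suc m) X \<iota> r"
  obtains p Y where "short_exact C (\<iota> (Suc m)) p" "\<iota> (Suc m) \<in> Hom C (X m) (X (Suc m))"
    "p \<in> Hom C (X (Suc m)) Y" "Y \<in> slice C \<eta> (r (Suc m))" "\<not> is_iso C (\<iota> (Suc m))"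
proof -
  have top: "Suc m \<in> {1..Suc m}"
    by simp
  then have "\<iota> (Suc m) \<in> Hom C (X (Suc m - 1)) (X (Suc m)) \<and> \<not> is_iso C (\<iota> (Suc m)) \<and>
      (\<exists>p. short_exact C (\<iota> (Suc m)) p)"
    using assms unfolding HN_with_slopes_def filtration_def by blast
  then obtain p where p: "short_exact C (\<iota> (Suc m)) p"
      and \<iota>: "\<iota> (Suc m) \<in> Hom C (X m) (X (Suc m))" "\<not> is_iso C (\<iota> (Suc m))"
    by auto
  have "p \<in> Hom C (X (Suc m)) (Cod C p)"
    using short_exact_Hom[OF p] \<iota>(1) by (auto simp: Hom_def)
  moreover have "Cod C p \<in> slice C \<eta> (r (Suc m))"
    using assms p top unfolding HN_with_slopes_def short_exact_def by blast
  ultimately show thesis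
    using that[OF p \<iota>(1)] \<iota>(2) by blast
qed

text \<open>
  Every quotient with slope above \<open>s\<close> is torsion at \<open>s\<close>, and torsion classes are closed under
  extensions.
\<close>

lemma HN_top_torsion:
  assumes "HN_with_slopes n X \<iota> r" "s \<in> {0..1}" "\<And>k. k \<in> {1..n} \<Longrightarrow> s < r k"
  shows "X n \<in> \<eta> s"
  using assms
proof (induction n)
  case 0
  then show ?case
    using zero_object_torsion[OF chain_pair] HN_bottom by blast
next
  case (Suc m)
  have m: "X m \<in> \<eta> s"
    using Suc.IH[OF HN_truncate[OF Suc.prems(1)] Suc.prems(2)] Suc.prems(3) by simp
  obtain p Y where p: "short_exact C (\<iota> (Suc m)) p" "\<iota> (Suc m) \<in> Hom C (X m) (X (Suc m))"
      "p \<in> Hom C (X (Suc m)) Y" "Y \<in> slice C \<eta> (r (Suc m))"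
    using HN_top_sequence[OF Suc.prems(1)] .
  have "r (Suc m) \<in> {0..1}"
    using HN_slope_bounds[OF Suc.prems(1), of "Suc m"] by simp
  then have "Y \<in> \<eta> s"
    using p(4) Suc.prems(2) Suc.prems(3)[of "Suc m"] by (simp add: slice_iff)
  then show ?case
    using torsion_extension[OF chain_pair[OF Suc.prems(2)] _ p(2,3) m] p(1)
    unfolding short_exact_def by blast
qed

lemma HN_length_0_iff:
  assumes "HN_with_slopes n X \<iota> r"
  shows "n = 0 \<longleftrightarrow> zero_object C (X n)"
proof
  assume "n = 0"
  then show "zero_object C (X n)"
    using HN_bottom[OF assms] by simp
next
  assume zero: "zero_object C (X n)"
  show "n = 0"
  proof (cases n)
    case (Suc m)
    obtain p where "short_exact C (\<iota> n) p" "\<iota> n \<in> Hom C (X m) (X n)" "\<not> is_iso C (\<iota> n)"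
      using HN_top_sequence[of m X \<iota> r] assms unfolding Suc by blast
    then show ?thesis
      using zero_object_subobject zero unfolding short_exact_def by blast
  qed
qed


section \<open>Existence\<close>

lemma HN_extend:
  assumes HN: "HN_with_slopes m X \<iota> r" and x: "x \<in> {0..1}"
    and slopes: "\<And>k. k \<in> {1..m} \<Longrightarrow> x < r k"
    and t: "short_exact C t g" "t \<in> Hom C (X m) M" "\<not> is_iso C t"
    and top: "Cod C g \<in> slice C \<eta> x"
  shows "HN_with_slopes (Suc m) (X(Suc m := M)) (\<iota>(Suc m := t)) (r(Suc m := x))"
proof -
  have filt: "filtration C M (Suc m) (X(Suc m := M)) (\<iota>(Suc m := t))"
    using HN t Hom_Obj(2)[OF t(2)] unfolding HN_with_slopes_def filtration_def
    by (auto simp: le_Suc_eq)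
  have cok: "Cod C p \<in> slice C \<eta> x" if p: "is_cokernel C p t" for p
  proof -
    have "is_cokernel C g t"
      using t(1) unfolding short_exact_def by blast
    then obtain u where "u \<in> Hom C (Cod C g) (Cod C p)" "is_iso C u"
      by (rule cokernel_unique[OF _ p])
    then show ?thesis
      using slice_iso_closed[OF x top] by blast
  qed
  have order: "(r(Suc m := x)) k > (r(Suc m := x)) k' \<longleftrightarrow> k < k'"
    if "k \<in> {1..Suc m}" "k' \<in> {1..Suc m}" for k k'
  proof (cases "k = Suc m \<or> k' = Suc m")
    case True
    then show ?thesis
      using that slopes[of k] slopes[of k'] by (cases "k = Suc m"; cases "k' = Suc m") auto
  next
    case False
    then have "k \<in> {1..m}" "k' \<in> {1..m}"
      using that by auto
    then show ?thesis
      using False HN unfolding HN_with_slopes_def by simp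
  qed
  show ?thesis
    unfolding HN_with_slopes_def
  proof (intro conjI ballI allI impI)
    fix k
    assume k: "k \<in> {1..Suc m}"
    show "(r(Suc m := x)) k \<in> {0..1}"
      using HN k x unfolding HN_with_slopes_def by (cases "k = Suc m") auto
    fix p
    assume p: "is_cokernel C p ((\<iota>(Suc m := t)) k)"
    show "Cod C p \<in> slice C \<eta> ((r(Suc m := x)) k)"
    proof (cases "k = Suc m")
      case True
      then show ?thesis
        using cok p by simp
    next
      case False
      then have "k \<in> {1..m}" "is_cokernel C p (\<iota> k)"
        using k p by auto
      then show ?thesis
        using False HN unfolding HN_with_slopes_def by auto
    qed
  qed (use filt order in auto)
qed

text \<open>
  Only indices strictly below \<open>x\<close> occur in the torsion condition, to match the slice at \<open>x\<close>,
  which does not see the value of \<open>\<eta>\<close> at \<open>x\<close> itself. This makes the property insensitive to the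
  values at the jumps of \<open>\<eta>\<close>.
\<close>

definition HN_from :: "real \<Rightarrow> bool" where
  "HN_from x \<longleftrightarrow> (\<forall>M \<in> Obj C. (\<forall>s \<in> {0..<x}. M \<in> \<eta> s) \<longrightarrow>
     (\<exists>n X \<iota> r. HN_with_slopes n X \<iota> r \<and> X n = M \<and> (\<forall>k \<in> {1..n}. x \<le> r k)))"

lemma HN_fromE:
  assumes "HN_from x" "M \<in> Obj C" "\<And>s. s \<in> {0..<x} \<Longrightarrow> M \<in> \<eta> s"
  obtains n X \<iota> r where "HN_with_slopes n X \<iota> r" "X n = M" "\<forall>k \<in> {1..n}. x \<le> r k"
  using assms unfolding HN_from_def by blast

lemma HN_of_zero_object:
  assumes "zero_object C Z"
  shows "HN_with_slopes 0 (\<lambda>_. Z) \<iota> r"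
  using assms unfolding HN_with_slopes_def filtration_def zero_object_def by auto

lemma HN_from_1: "HN_from 1"
  unfolding HN_from_def
proof (intro ballI impI)
  fix M
  assume M: "M \<in> Obj C" "\<forall>s \<in> {0..<1}. M \<in> \<eta> s"
  show "\<exists>n X \<iota> r. HN_with_slopes n X \<iota> r \<and> X n = M \<and> (\<forall>k \<in> {1..n}. 1 \<le> r k)"
  proof (cases "zero_object C M")
    case True
    have "HN_with_slopes 0 (\<lambda>_. M) (\<lambda>_. Id C M) (\<lambda>_. 1)"
      using HN_of_zero_object True .
    then show ?thesis
      by (intro exI[of _ 0] exI[of _ "\<lambda>_. M"] exI[of _ "\<lambda>_. Id C M"] exI[of _ "\<lambda>_. 1"]) simp
  next
    case False
    obtain Z where Z: "zero_object C Z"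
      using ex_zero_object by blast
    have zero: "Zero C Z M \<in> Hom C Z M"
      using Zero_in_Hom Z M(1) unfolding zero_object_def by blast
    have "\<not> is_iso C (Zero C Z M)"
      using zero_object_iso[OF Z zero] False by blast
    moreover have "Cod C (Id C M) \<in> slice C \<eta> 1"
      using M Id_in_Hom[OF M(1)] by (simp add: slice_iff Hom_def)
    ultimately have "HN_with_slopes (Suc 0) ((\<lambda>_. Z)(Suc 0 := M))
        ((\<lambda>_. Id C M)(Suc 0 := Zero C Z M)) ((\<lambda>_. 1)(Suc 0 := 1))"
      using short_exact_from_zero_object[OF Z M(1)] zero
      by (intro HN_extend[where g = "Id C M"] HN_of_zero_object[OF Z]) simp_all
    then show ?thesis
      by (intro exI[of _ "Suc 0"] exI[of _ "(\<lambda>_. Z)(Suc 0 := M)"]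
        exI[of _ "(\<lambda>_. Id C M)(Suc 0 := Zero C Z M)"] exI[of _ "(\<lambda>_. 1)(Suc 0 := 1)"]) simp
  qed
qed

text \<open>
  The top quotient of the new filtration is the torsionfree part of \<open>M\<close> with respect to \<open>\<eta> s\<close>.
  As a quotient of \<open>M\<close> it is torsion below \<open>x\<close>, and constancy of \<open>\<eta>\<close> on \<open>(x, s]\<close> makes it
  torsionfree at every point above \<open>x\<close>, not only from \<open>s\<close> on.
\<close>

lemma HN_from_step_left:
  assumes x: "0 \<le> x" "x < s" "s \<le> 1" and const: "\<And>r. x < r \<Longrightarrow> r \<le> s \<Longrightarrow> \<eta> r = \<eta> s"
    and s: "HN_from s"
  shows "HN_from x"
  unfolding HN_from_def
proof (intro ballI impI)
  fix M
  assume M: "M \<in> Obj C" "\<forall>s \<in> {0..<x}. M \<in> \<eta> s"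
  have s01: "s \<in> {0..1}"
    using x by simp
  have below: "Y \<in> \<eta> s'" if "Y \<in> \<eta> s" "s' \<in> {0..<s}" for Y s'
    using chain_antimono[of s' s] that x by auto
  show "\<exists>n X \<iota> r. HN_with_slopes n X \<iota> r \<and> X n = M \<and> (\<forall>k \<in> {1..n}. x \<le> r k)"
  proof (cases "M \<in> \<eta> s")
    case True
    obtain n X \<iota> r where HN: "HN_with_slopes n X \<iota> r" "X n = M" "\<forall>k \<in> {1..n}. s \<le> r k"
      using HN_fromE[OF s M(1) below[OF True]] .
    have "\<forall>k \<in> {1..n}. x \<le> r k"
      using HN(3) x by force
    then show ?thesis
      using HN(1,2) by blast
  next
    case False
    obtain t g A B where t: "short_exact C t g" "t \<in> Hom C A M" "g \<in> Hom C M B"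
        "A \<in> \<eta> s" "B \<in> \<F> s"
      using torsion_pair_sequence[OF chain_pair[OF s01] M(1)] .
    obtain m X \<iota> r where HN: "HN_with_slopes m X \<iota> r" "X m = A" "\<forall>k \<in> {1..m}. s \<le> r k"
      using HN_fromE[OF s Hom_Obj(1)[OF t(2)] below[OF t(4)]] .
    have "\<not> is_iso C t"
      using False torsion_iso_closed[OF chain_pair[OF s01] t(4,2)] by blast
    moreover have "B \<in> slice C \<eta> x"
    proof -
      have cok: "is_cokernel C g t"
        using t(1) unfolding short_exact_def by blast
      have "B \<in> \<eta> s'" if s': "s' \<in> {0..<x}" for s'
      proof -
        have "s' \<in> {0..1}" "M \<in> \<eta> s'"
          using s' x M(2) by auto
        then show ?thesis
          using torsion_quotient[OF chain_pair cok t(3)] by blast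
      qed
      moreover have "B \<in> \<F> s'" if s': "s' \<in> {x<..1}" for s'
      proof (cases "s' \<le> s")
        case True
        then have "\<eta> s' = \<eta> s"
          using const[of s'] s' by simp
        then show ?thesis
          using t(5) by simp
      next
        case False
        then show ?thesis
          using torsionfree_mono[of s s'] t(5) s' x by auto
      qed
      ultimately show ?thesis
        using x by (simp add: slice_iff)
    qed
    moreover have "Cod C g = B"
      using t(3) by (simp add: Hom_def)
    moreover have "x < r k" if "k \<in> {1..m}" for k
      using HN(3) that x(2) by force
    moreover have "x \<in> {0..1}"
      using x by simp
    ultimately have extended: "HN_with_slopes (Suc m) (X(Suc m := M)) (\<iota>(Suc m := t)) (r(Suc m := x))"
      using HN(1,2) t(1,2) by (intro HN_extend[where g = g]) simp_all
    have "x \<le> (r(Suc m := x)) k" if "k \<in> {1..Suc m}" for k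
      using HN(3) that x(2) by (cases "k = Suc m") force+
    then show ?thesis
      using extended by (intro exI[of _ "Suc m"] exI[of _ "X(Suc m := M)"] exI[of _ "\<iota>(Suc m := t)"]
        exI[of _ "r(Suc m := x)"]) simp
  qed
qed

lemma HN_from_jump_left:
  assumes "HN_from x" "0 < \<sigma>" "\<sigma> < y" "y < x" "x \<le> 1"
    and const: "\<And>r. \<sigma> \<le> r \<Longrightarrow> r < x \<Longrightarrow> \<eta> r = \<eta> \<sigma>"
  shows "HN_from y"
  unfolding HN_from_def
proof (intro ballI impI)
  fix M
  assume M: "M \<in> Obj C" "\<forall>s \<in> {0..<y}. M \<in> \<eta> s"
  have below: "M \<in> \<eta> s" if "s \<in> {0..<x}" for s
    using M(2) const[of s] that assms(2-4) by (cases "\<sigma> \<le> s") auto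
  obtain n X \<iota> r where HN: "HN_with_slopes n X \<iota> r" "X n = M" "\<forall>k \<in> {1..n}. x \<le> r k"
    using HN_fromE[OF assms(1) M(1) below] .
  have "\<forall>k \<in> {1..n}. y \<le> r k"
    using HN(3) assms(4) by force
  then show "\<exists>n X \<iota> r. HN_with_slopes n X \<iota> r \<and> X n = M \<and> (\<forall>k \<in> {1..n}. y \<le> r k)"
    using HN(1,2) by blast
qed

text \<open>
  Descent from 1 to 0: constancy to the right of the infimum of all good points makes the infimum
  itself good, and constancy to its left would produce smaller good points if it were positive.
\<close>

lemma HN_from_0: "HN_from 0"
proof -
  define S where "S = {x \<in> {0..1}. HN_from x}"
  define x where "x = Inf S"
  have S1: "1 \<in> S"
    unfolding S_def using HN_from_1 by simp
  have bdd: "bdd_below S"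
    unfolding S_def by (rule bdd_belowI[of _ 0]) simp
  have x1: "x \<le> 1"
    unfolding x_def using S1 bdd by (rule cInf_lower)
  have x0: "0 \<le> x"
    unfolding x_def using S1 by (intro cInf_greatest) (auto simp: S_def)
  have good: "HN_from x"
  proof (cases "x = 1")
    case True
    then show ?thesis
      using HN_from_1 by simp
  next
    case False
    then have "x < 1"
      using x1 by simp
    obtain \<sigma> where \<sigma>: "x < \<sigma>" "\<sigma> < 1" "\<And>r. x < r \<Longrightarrow> r \<le> \<sigma> \<Longrightarrow> \<eta> r = \<eta> \<sigma>"
      using chain_constant_right[OF x0 \<open>x < 1\<close>] by blast
    obtain s where s: "s \<in> S" "s < \<sigma>"
      using cInf_lessD[of S \<sigma>] S1 \<sigma>(1) unfolding x_def by blast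
    have "x \<le> s"
      unfolding x_def using s(1) bdd by (rule cInf_lower)
    then show ?thesis
    proof (cases "x = s")
      case False
      have const: "\<eta> r = \<eta> s" if "x < r" "r \<le> s" for r
        using \<sigma>(3)[of r] \<sigma>(3)[of s] that s(2) by simp
      have "x < s" "s \<le> 1" "HN_from s"
        using False \<open>x \<le> s\<close> s(1) unfolding S_def by auto
      then show ?thesis
        using HN_from_step_left[OF x0 _ _ const] by blast
    qed (use s in \<open>simp add: S_def\<close>)
  qed
  have "x = 0"
  proof (rule ccontr)
    assume "x \<noteq> 0"
    then have "0 < x"
      using x0 by simp
    obtain \<sigma> where \<sigma>: "0 < \<sigma>" "\<sigma> < x" "\<And>r. \<sigma> \<le> r \<Longrightarrow> r < x \<Longrightarrow> \<eta> r = \<eta> \<sigma>"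
      using chain_constant_left[OF \<open>0 < x\<close> x1] by blast
    obtain y where y: "\<sigma> < y" "y < x"
      using dense[OF \<sigma>(2)] by blast
    have "HN_from y"
      using HN_from_jump_left[OF good \<sigma>(1) y x1 \<sigma>(3)] .
    then have "y \<in> S"
      unfolding S_def using y \<sigma> x1 by simp
    then have "x \<le> y"
      unfolding x_def using bdd by (rule cInf_lower)
    then show False
      using y by simp
  qed
  then show ?thesis
    using good by simp
qed


section \<open>Uniqueness\<close>

text \<open>
  Otherwise some \<open>s\<close> lies strictly between the two slopes. The filtered object would be torsion at
  \<open>s\<close> by its first filtration, while the top quotient of the second one is torsionfree at \<open>s\<close>. A
  zero projection onto the top quotient makes the last inclusion an isomorphism, against
  strictness of the filtration.
\<close>

lemma HN_smallest_slope_le: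
  assumes HN: "HN_with_slopes n X \<iota> r" and HN': "HN_with_slopes (Suc m') X' \<iota>' r'"
    and \<phi>: "\<phi> \<in> Hom C (X n) (X' (Suc m'))" "is_iso C \<phi>" and n: "0 < n"
  shows "r n \<le> r' (Suc m')"
proof (rule ccontr)
  assume "\<not> r n \<le> r' (Suc m')"
  then obtain s where s: "r' (Suc m') < s" "s < r n"
    using dense by (metis not_le)
  note b = HN_slope_bounds[OF HN] and b' = HN_slope_bounds[OF HN', of "Suc m'"]
  have s01: "s \<in> {0..1}"
    using s b(2)[of n] b'(1) n by auto
  have "s < r k" if "k \<in> {1..n}" for k
    using b(3)[OF that] s by simp
  then have "X n \<in> \<eta> s"
    using HN_top_torsion[OF HN s01] by blast
  then have X': "X' (Suc m') \<in> \<eta> s"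
    using torsion_iso_closed[OF chain_pair[OF s01] _ \<phi>] by blast
  obtain p Y where p: "short_exact C (\<iota>' (Suc m')) p"
      "\<iota>' (Suc m') \<in> Hom C (X' m') (X' (Suc m'))" "p \<in> Hom C (X' (Suc m')) Y"
      "Y \<in> slice C \<eta> (r' (Suc m'))" "\<not> is_iso C (\<iota>' (Suc m'))"
    using HN_top_sequence[OF HN'] .
  have "Y \<in> \<F> s"
    using p(4) s b' s01 by (simp add: slice_iff)
  then have "p = Zero C (X' (Suc m')) Y"
    using torsion_pair_Hom_Zero[OF chain_pair[OF s01] X'] p(3) by blast
  then have "is_iso C (\<iota>' (Suc m'))"
    using kernel_of_Zero_is_iso p(1,2) Hom_Obj(2)[OF p(3)] unfolding short_exact_def by blast
  then show False
    using p(5) by blast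
qed

text \<open>
  Unless it is the zero object at the bottom, the penultimate term \<open>X m\<close> is torsion for some \<open>s\<close>
  beyond the common smallest slope, whereas the top quotient of the other filtration is
  torsionfree there, so the map from \<open>X m\<close> to that quotient vanishes.
\<close>

lemma HN_lift_penultimate:
  assumes HN: "HN_with_slopes (Suc m) X \<iota> r" and HN': "HN_with_slopes (Suc m') X' \<iota>' r'"
    and slope: "r' (Suc m') = r (Suc m)" and \<phi>: "\<phi> \<in> Hom C (X (Suc m)) (X' (Suc m'))"
  obtains u where "u \<in> Hom C (X m) (X' m')" "\<iota>' (Suc m') \<cdot> u = \<phi> \<cdot> \<iota> (Suc m)"
proof -
  have \<iota>: "\<iota> (Suc m) \<in> Hom C (X m) (X (Suc m))"
    using HN_top_sequence[OF HN] by blast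
  obtain p Y where p: "short_exact C (\<iota>' (Suc m')) p"
      "\<iota>' (Suc m') \<in> Hom C (X' m') (X' (Suc m'))" "p \<in> Hom C (X' (Suc m')) Y"
      "Y \<in> slice C \<eta> (r' (Suc m'))"
    using HN_top_sequence[OF HN'] .
  have h: "\<phi> \<cdot> \<iota> (Suc m) \<in> Hom C (X m) (X' (Suc m'))"
    using Comp_in_Hom \<iota> \<phi> .
  have ph: "p \<cdot> (\<phi> \<cdot> \<iota> (Suc m)) \<in> Hom C (X m) Y"
    using Comp_in_Hom h p(3) .
  have "p \<cdot> (\<phi> \<cdot> \<iota> (Suc m)) = Zero C (X m) Y"
  proof (cases m)
    case 0
    then show ?thesis
      using from_zero_object[OF _ ph] HN_bottom[OF HN] by simp
  next
    case (Suc l)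
    then have "r (Suc m) < r m"
      using HN unfolding HN_with_slopes_def by simp
    then obtain s where s: "r (Suc m) < s" "s < r m"
      using dense by blast
    note trunc = HN_truncate[OF HN]
    note b = HN_slope_bounds[OF trunc] and b' = HN_slope_bounds[OF HN', of "Suc m'"]
    have s01: "s \<in> {0..1}"
      using s b(2)[of m] b'(1) Suc slope by simp
    have "s < r k" if "k \<in> {1..m}" for k
      using b(3)[OF that] s by simp
    then have "X m \<in> \<eta> s"
      using HN_top_torsion[OF trunc s01] by blast
    moreover have "Y \<in> \<F> s"
      using p(4) s b' s01 slope by (simp add: slice_iff)
    ultimately show ?thesis
      using torsion_pair_Hom_Zero[OF chain_pair[OF s01]] ph by blast
  qed
  then show thesis
    using kernel_lift[OF _ p(2,3) h] p(1) that unfolding short_exact_def by blast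
qed

lemma HN_iso_penultimate:
  assumes HN: "HN_with_slopes (Suc m) X \<iota> r" and HN': "HN_with_slopes (Suc m') X' \<iota>' r'"
    and \<phi>: "\<phi> \<in> Hom C (X (Suc m)) (X' (Suc m'))" "is_iso C \<phi>"
  obtains u where "u \<in> Hom C (X m) (X' m')" "is_iso C u"
    "\<phi> \<cdot> \<iota> (Suc m) = \<iota>' (Suc m') \<cdot> u"
proof -
  obtain \<psi> where \<psi>: "\<psi> \<in> Hom C (X' (Suc m')) (X (Suc m))" "is_iso C \<psi>"
      "\<psi> \<cdot> \<phi> = Id C (X (Suc m))" "\<phi> \<cdot> \<psi> = Id C (X' (Suc m'))"
    using iso_inverse[OF \<phi>] .
  have slope: "r (Suc m) = r' (Suc m')"
    using HN_smallest_slope_le[OF HN HN' \<phi>] HN_smallest_slope_le[OF HN' HN \<psi>(1,2)] by simp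
  obtain u where u: "u \<in> Hom C (X m) (X' m')" "\<iota>' (Suc m') \<cdot> u = \<phi> \<cdot> \<iota> (Suc m)"
    using HN_lift_penultimate[OF HN HN' slope[symmetric] \<phi>(1)] .
  obtain v where v: "v \<in> Hom C (X' m') (X m)" "\<iota> (Suc m) \<cdot> v = \<psi> \<cdot> \<iota>' (Suc m')"
    using HN_lift_penultimate[OF HN' HN slope \<psi>(1)] .
  obtain p where p: "short_exact C (\<iota> (Suc m)) p" and \<iota>: "\<iota> (Suc m) \<in> Hom C (X m) (X (Suc m))"
    using HN_top_sequence[OF HN] by blast
  obtain p' where p': "short_exact C (\<iota>' (Suc m')) p'"
      and \<iota>': "\<iota>' (Suc m') \<in> Hom C (X' m') (X' (Suc m'))"
    using HN_top_sequence[OF HN'] by blast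
  have "\<iota> (Suc m) \<cdot> (v \<cdot> u) = \<psi> \<cdot> (\<phi> \<cdot> \<iota> (Suc m))"
    using Comp_assoc[OF u(1) v(1) \<iota>] Comp_assoc[OF u(1) \<iota>' \<psi>(1)] u v by simp
  also have "\<dots> = \<iota> (Suc m) \<cdot> Id C (X m)"
    using Comp_assoc[OF \<iota> \<phi>(1) \<psi>(1)] \<psi> Id_Comp[OF \<iota>] Comp_Id[OF \<iota>] by simp
  finally have "v \<cdot> u = Id C (X m)"
    using kernel_mono[OF _ \<iota>, of p] p Comp_in_Hom[OF u(1) v(1)] Id_in_Hom Hom_Obj(1)[OF \<iota>]
    unfolding short_exact_def by blast
  moreover have "\<iota>' (Suc m') \<cdot> (u \<cdot> v) = \<phi> \<cdot> (\<psi> \<cdot> \<iota>' (Suc m'))"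
    using Comp_assoc[OF v(1) u(1) \<iota>'] Comp_assoc[OF v(1) \<iota> \<phi>(1)] u v by simp
  then have "\<iota>' (Suc m') \<cdot> (u \<cdot> v) = \<iota>' (Suc m') \<cdot> Id C (X' m')"
    using Comp_assoc[OF \<iota>' \<psi>(1) \<phi>(1)] \<psi> Id_Comp[OF \<iota>'] Comp_Id[OF \<iota>'] by simp
  then have "u \<cdot> v = Id C (X' m')"
    using kernel_mono[OF _ \<iota>', of p'] p' Comp_in_Hom[OF v(1) u(1)] Id_in_Hom Hom_Obj(1)[OF \<iota>']
    unfolding short_exact_def by blast
  ultimately have "is_iso C u"
    using is_iso_iff_inverse[OF u(1)] v(1) by blast
  then show thesis
    using that u by simp
qed

text \<open>
  The two filtered objects are only assumed isomorphic, not equal, because this is what the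
  induction produces for the penultimate terms.
\<close>

lemma HN_unique_over_iso:
  assumes "HN_with_slopes n X \<iota> r" "HN_with_slopes n' X' \<iota>' r'"
    and "\<phi> \<in> Hom C (X n) (X' n')" "is_iso C \<phi>"
  shows "n = n' \<and> (\<exists>\<psi>. (\<forall>k \<le> n. \<psi> k \<in> Hom C (X k) (X' k) \<and> is_iso C (\<psi> k)) \<and>
    (\<forall>k \<in> {1..n}. \<psi> k \<cdot> \<iota> k = \<iota>' k \<cdot> \<psi> (k - 1)) \<and> \<psi> n = \<phi>)"
  using assms
proof (induction n arbitrary: n' \<phi>)
  case 0
  have "zero_object C (X' n')"
    using zero_object_iso[OF HN_bottom[OF 0(1)] 0(3,4)] .
  then have "n' = 0"
    using HN_length_0_iff[OF 0(2)] by blast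
  then show ?case
    using 0 by (auto intro!: exI[of _ "\<lambda>_. \<phi>"])
next
  case (Suc m)
  have "n' \<noteq> 0"
  proof
    assume "n' = 0"
    then have "zero_object C (X' n')"
      using HN_bottom[OF Suc.prems(2)] by simp
    then have "zero_object C (X (Suc m))"
      using iso_inverse[OF Suc.prems(3,4)] zero_object_iso by blast
    then show False
      using HN_length_0_iff[OF Suc.prems(1)] by simp
  qed
  then obtain m' where n': "n' = Suc m'"
    using not0_implies_Suc by blast
  obtain u where u: "u \<in> Hom C (X m) (X' m')" "is_iso C u"
      "\<phi> \<cdot> \<iota> (Suc m) = \<iota>' (Suc m') \<cdot> u"
    using HN_iso_penultimate[of m X \<iota> r m' X' \<iota>' r' \<phi>] Suc.prems n' by blast
  have IH: "m = m' \<and> (\<exists>\<psi>. (\<forall>k \<le> m. \<psi> k \<in> Hom C (X k) (X' k) \<and> is_iso C (\<psi> k)) \<and>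
    (\<forall>k \<in> {1..m}. \<psi> k \<cdot> \<iota> k = \<iota>' k \<cdot> \<psi> (k - 1)) \<and> \<psi> m = u)"
    using Suc.IH[OF HN_truncate HN_truncate u(1,2)] Suc.prems(1,2) n' by blast
  then obtain \<psi> where \<psi>: "\<And>k. k \<le> m \<Longrightarrow> \<psi> k \<in> Hom C (X k) (X' k) \<and> is_iso C (\<psi> k)"
      "\<And>k. k \<in> {1..m} \<Longrightarrow> \<psi> k \<cdot> \<iota> k = \<iota>' k \<cdot> \<psi> (k - 1)" "\<psi> m = u"
    by blast
  let ?\<psi> = "\<psi>(Suc m := \<phi>)"
  have "?\<psi> k \<in> Hom C (X k) (X' k) \<and> is_iso C (?\<psi> k)" if "k \<le> Suc m" for k
    using that \<psi>(1)[of k] Suc.prems(3,4) n' IH by (cases "k = Suc m") auto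
  moreover have "?\<psi> k \<cdot> \<iota> k = \<iota>' k \<cdot> ?\<psi> (k - 1)" if "k \<in> {1..Suc m}" for k
  proof (cases "k = Suc m")
    case True
    then show ?thesis
      using u(3) \<psi>(3) IH by simp
  next
    case False
    then have "k \<in> {1..m}" "k - 1 \<noteq> Suc m"
      using that by auto
    then show ?thesis
      using False \<psi>(2)[of k] by simp
  qed
  ultimately show ?case
    using n' IH by (auto intro!: exI[of _ ?\<psi>])
qed

end


section \<open>Harder-Narasimhan filtrations exist and are unique\<close>

theorem theorem1p3:
  fixes Q :: "('o, 'm) add_cat" and \<eta> :: "real \<Rightarrow> 'o set" and M :: 'o
  assumes "quasi_abelian_category Q"
    and "\<eta> \<in> torsion_chains Q"
    and "M \<in> Obj Q"
  shows "(\<exists>n X \<iota>. HN_filtration Q \<eta> M n X \<iota>) \<and>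
    (\<forall>n X \<iota> n' X' \<iota>'. HN_filtration Q \<eta> M n X \<iota> \<and> HN_filtration Q \<eta> M n' X' \<iota>'
       \<longrightarrow> filtrations_isomorphic Q M n X \<iota> n' X' \<iota>')"
proof -
  interpret quasi_abelian_category Q
    using assms(1) .
  interpret torsion_chain_category Q \<eta>
    by unfold_locales (fact assms(2))
  have id: "Id Q M \<in> Hom Q M M" "is_iso Q (Id Q M)"
    using Id_in_Hom[OF assms(3)] Comp_Id is_iso_iff_inverse by blast+
  have "\<exists>n X \<iota>. HN_filtration Q \<eta> M n X \<iota>"
    using HN_from_0 assms(3) HN_filtration_iff_slopes unfolding HN_from_def by force
  moreover have "filtrations_isomorphic Q M n X \<iota> n' X' \<iota>'"
    if HN: "HN_filtration Q \<eta> M n X \<iota>" "HN_filtration Q \<eta> M n' X' \<iota>'" for n X \<iota> n' X' \<iota>'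
  proof -
    obtain r r' where "HN_with_slopes n X \<iota> r" "HN_with_slopes n' X' \<iota>' r'" "X n = M" "X' n' = M"
      using HN HN_filtration_iff_slopes by blast
    moreover from this have "Id Q M \<in> Hom Q (X n) (X' n')"
      using id(1) by simp
    ultimately show ?thesis
      using HN_unique_over_iso[OF _ _ _ id(2)] unfolding filtrations_isomorphic_def by blast
  qed
  ultimately show ?thesis
    by blast
qed

end
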